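(* Let $(X,p)$ be a partial metric space, let $r\ge 0$, let $\{x_n\}$ be an $r$-convergent sequence in $X$, and let $\{y_n\}$ be a sequence in $LIM^{r}x_n$ that converges to $y\in X$. Then $y\in R\text{-}LIM^{r}x_n$.
   Context: A partial metric on a nonempty set $X$ is a function $p:X\times X\to[0,\infty)$ such that for all $x,y,z\in X$: (p1) $0\le p(x,x)\le p(x,y)$; (p2) $x=y \iff p(x,x)=p(x,y)=p(y,y)$; (p3) $p(x,y)=p(y,x)$; (p4) $p(x,y)\le p(x,z)+p(z,y)-p(z,z)$. The pair $(X,p)$ is a partial metric space. A sequence $\{x_n\}$ in $X$ converges to $x\in X$ if for every $\epsilon>0$ there is $k\in\mathbb{N}$ such that $|p(x_n,x)-p(x,x)|<\epsilon$ for all $n\ge k$. For $r\ge 0$, $\{x_n\}$ is $r$-convergent to $x\in X$ if for every $\epsilon>0$ there is $k\in\mathbb{N}$ such that $|p(x_n,x)-p(x,x)|<r+\epsilon$ for all $n\ge k$; it is $r$-convergent if this holds for some $x\in X$. $LIM^{r}x_n$ is the set of all $x\in X$ such that $\{x_n\}$ is $r$-convergent to $x$. A sequence $\{x_n\}$ is $r$-convergent to $x$ from right if for every $\epsilon>0$ there is $k\in\mathbb{N}$ such that $|p(x_n,x)-p(x,x)|<r+\epsilon$ for all $n\ge k$ with $p(x_n,x)\ge p(x,x)$. $R\text{-}LIM^{r}x_n$ denotes the set of all $x\in X$ such that $\{x_n\}$ is $r$-convergent to $x$ from right. *)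

theory Defs imports Complex_Main begin

text \<open>
  Only the values of \<open>p\<close> on \<open>X\<close> matter. Nonnegativity of \<open>p\<close> on all of \<open>X \<times> X\<close>
  is part of the first inequality chain, \<open>0 \<le> p x x \<le> p x y\<close>.
\<close>
locale partial_metric =
  fixes X :: "'a set" and p :: "'a \<Rightarrow> 'a \<Rightarrow> real"
  assumes nonempty: "X \<noteq> {}"
    and p1: "\<And>x y. x \<in> X \<Longrightarrow> y \<in> X \<Longrightarrow> 0 \<le> p x x \<and> p x x \<le> p x y"
    and p2: "\<And>x y. x \<in> X \<Longrightarrow> y \<in> X \<Longrightarrow> x = y \<longleftrightarrow> p x x = p x y \<and> p x y = p y y"
    and p3: "\<And>x y. x \<in> X \<Longrightarrow> y \<in> X \<Longrightarrow> p x y = p y x"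
    and p4: "\<And>x y z. x \<in> X \<Longrightarrow> y \<in> X \<Longrightarrow> z \<in> X \<Longrightarrow> p x y \<le> p x z + p z y - p z z"

definition pm_converges :: "'a set \<Rightarrow> ('a \<Rightarrow> 'a \<Rightarrow> real) \<Rightarrow> (nat \<Rightarrow> 'a) \<Rightarrow> 'a \<Rightarrow> bool" where
  "pm_converges X p s x \<longleftrightarrow>
     x \<in> X \<and> (\<forall>\<epsilon>>0. \<exists>k. \<forall>n\<ge>k. \<bar>p (s n) x - p x x\<bar> < \<epsilon>)"

definition r_converges_to ::
    "'a set \<Rightarrow> ('a \<Rightarrow> 'a \<Rightarrow> real) \<Rightarrow> real \<Rightarrow> (nat \<Rightarrow> 'a) \<Rightarrow> 'a \<Rightarrow> bool" where
  "r_converges_to X p r s x \<longleftrightarrow>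
     x \<in> X \<and> (\<forall>\<epsilon>>0. \<exists>k. \<forall>n\<ge>k. \<bar>p (s n) x - p x x\<bar> < r + \<epsilon>)"

definition r_convergent :: "'a set \<Rightarrow> ('a \<Rightarrow> 'a \<Rightarrow> real) \<Rightarrow> real \<Rightarrow> (nat \<Rightarrow> 'a) \<Rightarrow> bool" where
  "r_convergent X p r s \<longleftrightarrow> (\<exists>x\<in>X. r_converges_to X p r s x)"

definition LIM_r :: "'a set \<Rightarrow> ('a \<Rightarrow> 'a \<Rightarrow> real) \<Rightarrow> real \<Rightarrow> (nat \<Rightarrow> 'a) \<Rightarrow> 'a set" where
  "LIM_r X p r s = {x \<in> X. r_converges_to X p r s x}"

definition r_converges_right ::
    "'a set \<Rightarrow> ('a \<Rightarrow> 'a \<Rightarrow> real) \<Rightarrow> real \<Rightarrow> (nat \<Rightarrow> 'a) \<Rightarrow> 'a \<Rightarrow> bool" where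
  "r_converges_right X p r s x \<longleftrightarrow>
     x \<in> X \<and> (\<forall>\<epsilon>>0. \<exists>k. \<forall>n\<ge>k. p (s n) x \<ge> p x x \<longrightarrow> \<bar>p (s n) x - p x x\<bar> < r + \<epsilon>)"

definition R_LIM_r :: "'a set \<Rightarrow> ('a \<Rightarrow> 'a \<Rightarrow> real) \<Rightarrow> real \<Rightarrow> (nat \<Rightarrow> 'a) \<Rightarrow> 'a set" where
  "R_LIM_r X p r s = {x \<in> X. r_converges_right X p r s x}"

end

theory Submission imports Defs begin

text \<open>Fix one term \<open>y m\<close> close to \<open>y0\<close> and apply \<open>p4\<close>
  through it: \<open>p (x n) y0 - p y0 y0\<close> is at most
  \<open>p (x n) (y m) - p (y m) (y m)\<close> plus \<open>p (y m) y0 - p y0 y0\<close>. The first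
  difference is eventually below \<open>r + \<epsilon> / 2\<close>, the second is below
  \<open>\<epsilon> / 2\<close>.\<close>

theorem theorem3p7:
  fixes X :: "'a set" and p :: "'a \<Rightarrow> 'a \<Rightarrow> real" and r :: real
    and x y :: "nat \<Rightarrow> 'a" and y0 :: 'a
  assumes "partial_metric X p"
    and "r \<ge> 0"
    and "\<And>n. x n \<in> X"
    and "r_convergent X p r x"
    and "\<And>n. y n \<in> LIM_r X p r x"
    and "y0 \<in> X"
    and "pm_converges X p y y0"
  shows "y0 \<in> R_LIM_r X p r x"
proof -
  interpret partial_metric X p by fact
  have "\<exists>k. \<forall>n\<ge>k. p (x n) y0 \<ge> p y0 y0 \<longrightarrow> \<bar>p (x n) y0 - p y0 y0\<bar> < r + \<epsilon>"
    if "\<epsilon> > 0" for \<epsilon>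
  proof -
    have half: "\<epsilon> / 2 > 0" using that by simp
    \<comment> \<open>A single index \<open>m\<close> suffices; it is fixed before \<open>k\<close>,
      which may depend on it.\<close>
    obtain m where m: "\<bar>p (y m) y0 - p y0 y0\<bar> < \<epsilon> / 2"
      using assms(7) half unfolding pm_converges_def by blast
    have ym: "y m \<in> X" "r_converges_to X p r x (y m)"
      using assms(5)[of m] by (simp_all add: LIM_r_def)
    then obtain k where k: "\<And>n. n \<ge> k \<Longrightarrow> \<bar>p (x n) (y m) - p (y m) (y m)\<bar> < r + \<epsilon> / 2"
      using half unfolding r_converges_to_def by blast
    have "p (x n) y0 - p y0 y0 < r + \<epsilon>" if "n \<ge> k" for n
      using k[OF that] m p4[OF assms(3)[of n] assms(6) ym(1)] by linarith
    \<comment> \<open>The triangle inequality bounds the difference only from above; the guard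
      \<open>p (x n) y0 \<ge> p y0 y0\<close> turns this into a bound on the absolute value.\<close>
    then show ?thesis by auto
  qed
  then show ?thesis
    using assms(6) by (simp add: R_LIM_r_def r_converges_right_def)
qed

end
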